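(* Let $X$ be a real normed space, let $\mathcal F$ be a directionally fine family of closed cones in $X$, let $K\subset X$ be a closed cone, and let $A\subset X\setminus\{0_X\}$ be directionally compact with $A\cap K=\varnothing$. Let $C_1,\dots,C_n\in\mathcal F$ ($n\ge1$), with adapted defining functions $\varphi_1,\dots,\varphi_n$ respectively, be such that $\varphi_i\le0$ on $K$ and $K\cap C_i=\{0_X\}$ for every $i$, and \[ \Pi_{S_X}(A)\subset\bigcup_{i=1}^n\{\varphi_i>1/2\},\qquad A\subset\bigcup_{i=1}^n V_i\subset\bigcup_{i=1}^n\operatorname{int}C_i,\qquad V_i:=\{x\in X:\varphi_i(x)>\tfrac12\|x\|\}. \] Set $\Phi:=2\max_{1\le i\le n}\varphi_i$. Then $\Phi:X\to\mathbb R$ is continuous and positively homogeneous, and \[ \{\Phi\ge0\}=\bigcup_{i=1}^nC_i,\qquad \{\Phi\ge0\}\cap K=\{0_X\},\qquad \Phi(k)<0<\|a\|<\Phi(a) \] for every $k\in K\setminus\{0_X\}$ and every $a\in A$.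
   Context: $S_X$ is the unit sphere, $B(x,r)=\{y\in X:\|y-x\|\le r\}$, $\operatorname{cone}(A)=\{ta:t\ge0,\ a\in A\}$. A nonempty set $C\subset X$ is a cone if $tC\subset C$ for every $t\ge 0$; all cones are assumed proper, i.e. $\{0_X\}\subsetneq C\subsetneq X$ (not necessarily convex). A family $\mathcal F$ of closed cones in $X$ is directionally fine if for every $u\in S_X$ and $\varepsilon\in(0,1)$ there exists $C\in\mathcal F$ with $u\in\operatorname{int}C\subset C\subset\operatorname{cone}B(u,\varepsilon)$. For $A\subset X\setminus\{0_X\}$, $\Pi_{S_X}(A):=\{a/\|a\|:a\in A\}$; $A$ is directionally compact if $\Pi_{S_X}(A)$ is norm compact. A mapping is positively homogeneous if $\varphi(tx)=t\varphi(x)$ for all $t\ge0$, $x\in X$. For a closed cone $C$, an adapted defining function for $C$ (at some direction $u\in S_X\cap\operatorname{int}C$) is a continuous positively homogeneous $\varphi:X\to\mathbb R$ with $C=\{\varphi\ge0\}$, $\varphi(u)=1$, and $\varphi(x)\le\|x\|$ for every $x\in X$. *)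

theory Defs
  imports "HOL-Analysis.Analysis"
begin

(* Cones are proper throughout but need not be convex; the library predicate
   cone only expresses closure under scaling by nonnegative reals. *)
definition proper_cone :: "'a::real_vector set \<Rightarrow> bool" where
  "proper_cone C \<longleftrightarrow> cone C \<and> {0} \<subset> C \<and> C \<subset> UNIV"

definition closed_cone :: "'a::real_normed_vector set \<Rightarrow> bool" where
  "closed_cone C \<longleftrightarrow> proper_cone C \<and> closed C"

definition cone_gen :: "'a::real_vector set \<Rightarrow> 'a set" where
  "cone_gen A = {t *\<^sub>R a | t a. 0 \<le> t \<and> a \<in> A}"

lemma cone_gen_eq_cone_hull: "cone_gen A = cone hull A"
  by (simp add: cone_gen_def cone_hull_expl)

definition directionally_fine :: "'a::real_normed_vector set set \<Rightarrow> bool" where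
  "directionally_fine F \<longleftrightarrow>
     (\<forall>C\<in>F. closed_cone C) \<and>
     (\<forall>u\<in>sphere 0 1. \<forall>\<epsilon>\<in>{0<..<1}. \<exists>C\<in>F.
        u \<in> interior C \<and> interior C \<subseteq> C \<and> C \<subseteq> cone_gen (cball u \<epsilon>))"

definition sphere_proj :: "'a::real_normed_vector set \<Rightarrow> 'a set" where
  "sphere_proj A = {a /\<^sub>R norm a | a. a \<in> A}"

definition directionally_compact :: "'a::real_normed_vector set \<Rightarrow> bool" where
  "directionally_compact A \<longleftrightarrow> A \<subseteq> UNIV - {0} \<and> compact (sphere_proj A)"

definition pos_homogeneous :: "('a::real_vector \<Rightarrow> 'b::real_vector) \<Rightarrow> bool" where
  "pos_homogeneous \<phi> \<longleftrightarrow> (\<forall>t\<ge>0. \<forall>x. \<phi> (t *\<^sub>R x) = t *\<^sub>R \<phi> x)"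

definition adapted_at :: "'a::real_normed_vector set \<Rightarrow> 'a \<Rightarrow> ('a \<Rightarrow> real) \<Rightarrow> bool" where
  "adapted_at C u \<phi> \<longleftrightarrow>
     u \<in> sphere 0 1 \<inter> interior C \<and>
     continuous_on UNIV \<phi> \<and> pos_homogeneous \<phi> \<and>
     C = {x. \<phi> x \<ge> 0} \<and> \<phi> u = 1 \<and> (\<forall>x. \<phi> x \<le> norm x)"

definition adapted :: "'a::real_normed_vector set \<Rightarrow> ('a \<Rightarrow> real) \<Rightarrow> bool" where
  "adapted C \<phi> \<longleftrightarrow> (\<exists>u. adapted_at C u \<phi>)"

end

theory Submission
  imports Defs
begin

text \<open>A maximum of finitely many reals exceeds, or reaches, a threshold exactly when one of
  them does. At threshold 0 this turns {\<Phi> \<ge> 0} into the union of the sets {\<phi>_i \<ge>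
  0}, which are the cones C_i. Each C_i meets K only at the origin, so the union does too, and a
  nonzero point of K must have \<Phi> < 0. At threshold half the norm, membership of a point of A in
  some V_i gives max \<phi>_i > norm/2, and the factor 2 in \<Phi> makes this \<Phi> > norm.
  Continuity and positive homogeneity pass to finite maxima by
  \<open>continuous_on_Max_image\<close> and \<open>pos_homogeneous_Max_image\<close>.\<close>

lemma continuous_on_Max_image:
  fixes f :: "'i \<Rightarrow> 'a::topological_space \<Rightarrow> 'b::linorder_topology"
  assumes "finite I" "I \<noteq> {}" "\<And>i. i \<in> I \<Longrightarrow> continuous_on S (f i)"
  shows "continuous_on S (\<lambda>x. MAX i\<in>I. f i x)"
  using assms
proof (induction I rule: finite_ne_induct)
  case (singleton i)
  then show ?case by simp
next
  case (insert i I)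
  then have "continuous_on S (\<lambda>x. max (f i x) (MAX i\<in>I. f i x))"
    by (intro continuous_on_max) auto
  with insert show ?case by simp
qed

text \<open>Multiplication by t \<ge> 0 is monotone, t = 0 included, and a monotone map commutes
  with the maximum of a nonempty finite set.\<close>

lemma pos_homogeneous_Max_image:
  fixes f :: "'i \<Rightarrow> 'a::real_vector \<Rightarrow> real"
  assumes "finite I" "I \<noteq> {}" "\<And>i. i \<in> I \<Longrightarrow> pos_homogeneous (f i)"
  shows "pos_homogeneous (\<lambda>x. MAX i\<in>I. f i x)"
  unfolding pos_homogeneous_def
proof (intro allI impI)
  fix t :: real and x :: 'a
  assume t: "0 \<le> t"
  have "(\<lambda>i. f i (t *\<^sub>R x)) ` I = (*) t ` (\<lambda>i. f i x) ` I"
    unfolding image_image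
    using assms(3) t by (intro image_cong) (auto simp: pos_homogeneous_def)
  moreover have "mono ((*) t)"
    using t by (simp add: mono_def mult_left_mono)
  ultimately show "(MAX i\<in>I. f i (t *\<^sub>R x)) = t *\<^sub>R (MAX i\<in>I. f i x)"
    using assms(1,2) by (simp add: mono_Max_commute)
qed

theorem corollary3p6:
  fixes F :: "'a::real_normed_vector set set" and K A :: "'a set"
    and n :: nat and C V :: "nat \<Rightarrow> 'a set"
    and \<phi> :: "nat \<Rightarrow> 'a \<Rightarrow> real" and \<Phi> :: "'a \<Rightarrow> real"
  assumes "directionally_fine F"
    and "closed_cone K"
    and "A \<subseteq> UNIV - {0}" and "directionally_compact A" and "A \<inter> K = {}"
    and "n \<ge> 1"
    and "\<And>i. i \<in> {1..n} \<Longrightarrow> C i \<in> F"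
    and "\<And>i. i \<in> {1..n} \<Longrightarrow> adapted (C i) (\<phi> i)"
    and "\<And>i k. i \<in> {1..n} \<Longrightarrow> k \<in> K \<Longrightarrow> \<phi> i k \<le> 0"
    and "\<And>i. i \<in> {1..n} \<Longrightarrow> K \<inter> C i = {0}"
    and V_def: "V = (\<lambda>i. {x. \<phi> i x > 1/2 * norm x})"
    and "sphere_proj A \<subseteq> (\<Union>i\<in>{1..n}. {x. \<phi> i x > 1/2})"
    and "A \<subseteq> (\<Union>i\<in>{1..n}. V i)"
    and "(\<Union>i\<in>{1..n}. V i) \<subseteq> (\<Union>i\<in>{1..n}. interior (C i))"
    and Phi_def: "\<Phi> = (\<lambda>x. 2 * (MAX i\<in>{1..n}. \<phi> i x))"
  shows "continuous_on UNIV \<Phi> \<and> pos_homogeneous \<Phi> \<and>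
    {x. \<Phi> x \<ge> 0} = (\<Union>i\<in>{1..n}. C i) \<and>
    {x. \<Phi> x \<ge> 0} \<inter> K = {0} \<and>
    (\<forall>k\<in>K - {0}. \<Phi> k < 0) \<and>
    (\<forall>a\<in>A. 0 < norm a \<and> norm a < \<Phi> a)"
proof -
  \<comment> \<open>Nonemptiness matters: \<open>Max\<close> has no meaningful value on the empty
    set.\<close>
  have fin: "finite {1..n}" "{1..n} \<noteq> {}"
    using \<open>n \<ge> 1\<close> by auto
  have cont: "continuous_on UNIV (\<phi> i)" and hom: "pos_homogeneous (\<phi> i)"
    and C: "C i = {x. \<phi> i x \<ge> 0}" if "i \<in> {1..n}" for i
    using assms(8)[OF that] by (auto simp: adapted_def adapted_at_def)
  have ge: "\<Phi> x \<ge> 0 \<longleftrightarrow> (\<exists>i\<in>{1..n}. \<phi> i x \<ge> 0)" for x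
    using fin by (simp add: Phi_def Max_ge_iff)
  \<comment> \<open>The factor 2 in \<Phi> halves the threshold; with c = \<open>norm x\<close> the
    right-hand side says that x lies in some \<open>V i\<close>.\<close>
  have gr: "c < \<Phi> x \<longleftrightarrow> (\<exists>i\<in>{1..n}. \<phi> i x > 1/2 * c)" for c x
  proof -
    have "c < \<Phi> x \<longleftrightarrow> 1/2 * c < (MAX i\<in>{1..n}. \<phi> i x)"
      by (auto simp: Phi_def)
    also have "\<dots> \<longleftrightarrow> (\<exists>i\<in>{1..n}. \<phi> i x > 1/2 * c)"
      using fin by (subst Max_gr_iff) blast+
    finally show ?thesis .
  qed
  have "continuous_on UNIV \<Phi>"
    unfolding Phi_def using fin cont
    by (intro continuous_intros continuous_on_Max_image)
  moreover have "pos_homogeneous \<Phi>"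
    using pos_homogeneous_Max_image[OF fin hom]
    by (simp add: Phi_def pos_homogeneous_def)
  moreover have union: "{x. \<Phi> x \<ge> 0} = (\<Union>i\<in>{1..n}. C i)"
    using C by (auto simp: ge)
  \<comment> \<open>Intersection with K distributes over the union. That 0 itself belongs to the
    result requires at least one index.\<close>
  moreover have inter: "{x. \<Phi> x \<ge> 0} \<inter> K = {0}"
    using assms(10) fin(2) unfolding union by blast
  \<comment> \<open>Strictness comes from \<open>inter\<close>: if \<Phi> k \<ge> 0 with k in K,
    then k = 0.\<close>
  moreover have "\<forall>k\<in>K - {0}. \<Phi> k < 0"
    using inter by force
  \<comment> \<open>The covering of A by the sets \<open>V i\<close> is \<open>gr\<close> read at c
    = \<open>norm a\<close>; positivity of the norm holds because A omits the origin.\<close>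
  moreover have "\<forall>a\<in>A. 0 < norm a \<and> norm a < \<Phi> a"
    using assms(3,13) by (auto simp: gr V_def)
  ultimately show ?thesis by blast
qed

end
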